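(* Let $\boldsymbol\alpha=(\alpha_1,\dots,\alpha_n)\in\mathbb{R}^n$ with $\alpha_j\notin\pi\mathbb{Z}$ for $j=1,\dots,n$, let $1\le k\le n$, and suppose that $f\in L^1(\mathbb{R}^n)$ and $x_kf(\boldsymbol x)\in L^1(\mathbb{R}^n)$. Then, for all $\boldsymbol x\in\mathbb{R}^n$, $$\frac{\partial\big(e_{-\boldsymbol\alpha}(\boldsymbol x)\mathcal{F}_{\boldsymbol\alpha}(f)(\boldsymbol x)\big)}{\partial x_k}=e_{-\boldsymbol\alpha}(\boldsymbol x)\,\mathcal{F}_{\boldsymbol\alpha}\big(-iy_k\csc\alpha_k\,f(\boldsymbol y)\big)(\boldsymbol x).$$
   Context: For $\boldsymbol\alpha\in\mathbb{R}^n$ with all $\alpha_k\notin\pi\mathbb{Z}$, the chirp is $e_{\boldsymbol\alpha}(\boldsymbol x)=\exp\big(\tfrac{i}{2}\sum_{k=1}^n x_k^2\cot\alpha_k\big)$, so $e_{-\boldsymbol\alpha}=1/e_{\boldsymbol\alpha}$. The fractional Fourier transform of $f\in L^1(\mathbb{R}^n)$ is $$\mathcal{F}_{\boldsymbol\alpha}(f)(\boldsymbol u)=\frac{c(\boldsymbol\alpha)}{(\sqrt{2\pi})^n}\,e_{\boldsymbol\alpha}(\boldsymbol u)\int_{\mathbb{R}^n}f(\boldsymbol x)e_{\boldsymbol\alpha}(\boldsymbol x)e^{-i\sum_{k=1}^n x_ku_k\csc\alpha_k}\,d\boldsymbol x,\qquad c(\boldsymbol\alpha)=\prod_{k=1}^n\sqrt{1-i\cot\alpha_k}$$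 (principal square root). In $\mathcal{F}_{\boldsymbol\alpha}(h(\boldsymbol y))(\boldsymbol x)$, $\boldsymbol y$ is the dummy variable of the transformed function. *)

theory Defs
  imports "HOL-Analysis.Analysis"
begin

definition csc :: "real \<Rightarrow> real" where
  "csc a = 1 / sin a"

definition chirp :: "real ^ 'n \<Rightarrow> real ^ 'n \<Rightarrow> complex" where
  "chirp \<alpha> x = exp (\<i> / 2 * complex_of_real (\<Sum>k\<in>UNIV. (x $ k)\<^sup>2 * cot (\<alpha> $ k)))"

definition frft_const :: "real ^ 'n \<Rightarrow> complex" where
  "frft_const \<alpha> = (\<Prod>k\<in>UNIV. csqrt (1 - \<i> * complex_of_real (cot (\<alpha> $ k))))"

text \<open>
  The fractional Fourier transform of \<open>f\<close>, meaningful when \<open>f\<close> is integrable and no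
  component of \<open>\<alpha>\<close> is an integer multiple of \<open>pi\<close>. Integration is with respect to Lebesgue
  measure (the completion of \<open>lborel\<close>), so \<open>f\<close> need only be Lebesgue measurable.
\<close>
definition frft :: "real ^ 'n \<Rightarrow> (real ^ 'n \<Rightarrow> complex) \<Rightarrow> real ^ 'n \<Rightarrow> complex" where
  "frft \<alpha> f u =
     frft_const \<alpha> / complex_of_real (sqrt (2 * pi)) ^ CARD('n) * chirp \<alpha> u *
     (LINT x|lebesgue. f x * chirp \<alpha> x *
        exp (- \<i> * complex_of_real (\<Sum>k\<in>UNIV. x $ k * u $ k * csc (\<alpha> $ k))))"

text \<open>
  The partial derivative of \<open>g\<close> with respect to the \<open>k\<close>-th coordinate exists at \<open>x\<close> and
  equals \<open>D\<close>: ordinary derivative in that coordinate, the others being kept fixed.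
\<close>
definition has_partial_deriv ::
    "(real ^ 'n \<Rightarrow> complex) \<Rightarrow> 'n \<Rightarrow> complex \<Rightarrow> real ^ 'n \<Rightarrow> bool" where
  "has_partial_deriv g k D x \<longleftrightarrow>
     ((\<lambda>t. g (\<chi> j. if j = k then t else x $ j)) has_vector_derivative D) (at (x $ k))"

end

theory Submission
  imports Defs
begin

text \<open>
  The factor \<open>chirp (- \<alpha>)\<close> cancels the outer chirp of \<open>frft \<alpha>\<close>, so up to a constant the
  function to be differentiated is an ordinary Fourier integral of \<open>f \<cdot> chirp \<alpha>\<close>. When only the
  \<open>k\<close>-th coordinate \<open>t\<close> of the argument moves, the part of the phase that belongs to the other
  coordinates can be absorbed into the amplitude, and the integral takes the form
  \<open>\<integral> g y \<cdot> exp (\<i> a(y) t) dy\<close> with \<open>a(y) = - y\<^sub>k csc \<alpha>\<^sub>k\<close> and \<open>\<bar>g\<bar> = \<bar>f\<bar>\<close>. Such an integral may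
  be differentiated under the integral sign as soon as \<open>g\<close> and \<open>a \<cdot> g\<close> are integrable
  (lemma \<open>has_vector_derivative_oscillatory_integral\<close>), because \<open>\<bar>a \<cdot> g\<bar>\<close> dominates all
  difference quotients. Differentiation brings down the factor
  \<open>\<i> a(y) = - \<i> y\<^sub>k csc \<alpha>\<^sub>k\<close>, which is the one in the statement.
\<close>

lemma has_vector_derivative_quotientI:
  fixes F :: "real \<Rightarrow> 'a::real_normed_vector"
  assumes "((\<lambda>h. (F (s + h) - F s) /\<^sub>R h) \<longlongrightarrow> D) (at 0)"
  shows "(F has_vector_derivative D) (at s)"
proof -
  have "((\<lambda>h. norm ((F (s + h) - F s) /\<^sub>R h - D)) \<longlongrightarrow> 0) (at 0)"
    using assms by (simp add: LIM_zero tendsto_norm_zero)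
  moreover have "norm ((F (s + h) - F s) /\<^sub>R h - D) = norm (F (s + h) - F s - h *\<^sub>R D) / norm h"
    if "h \<noteq> 0" for h
  proof -
    have "(F (s + h) - F s) /\<^sub>R h - D = (F (s + h) - F s - h *\<^sub>R D) /\<^sub>R h"
      using that by (simp add: scaleR_diff_right)
    then show ?thesis by (simp add: divide_inverse mult.commute)
  qed
  ultimately have "((\<lambda>h. norm (F (s + h) - F s - h *\<^sub>R D) / norm h) \<longlongrightarrow> 0) (at 0)"
    by (subst (asm) filterlim_cong[OF refl refl])
       (auto simp: eventually_at_filter)
  then show ?thesis
    by (simp add: has_vector_derivative_def has_derivative_at bounded_linear_scaleR_left)
qed

text \<open>The bound is linear in \<open>t\<close>, so after division by \<open>t\<close> it is uniform in \<open>t\<close>.\<close>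

lemma norm_exp_imaginary_minus_one_le:
  "norm (exp (\<i> * complex_of_real t) - 1) \<le> \<bar>t\<bar>"
  using abs_sin_x_le_abs_x[of "t / 2"] by (simp add: dist_exp_i_1)

lemma exp_imaginary_quotient_tendsto:
  "((\<lambda>h. (exp (\<i> * complex_of_real (c * h)) - 1) /\<^sub>R h) \<longlongrightarrow> \<i> * complex_of_real c) (at 0)"
proof -
  have "((\<lambda>z. exp (\<i> * complex_of_real c * z)) has_field_derivative \<i> * complex_of_real c) (at 0)"
    by (auto intro!: derivative_eq_intros)
  then have "((\<lambda>z. (exp (\<i> * complex_of_real c * z) - 1) / z) \<longlongrightarrow> \<i> * complex_of_real c) (at 0)"
    by (simp add: has_field_derivative_iff)
  moreover have "filterlim complex_of_real (at 0) (at 0)"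
    by (auto simp: filterlim_at eventually_at_filter intro!: tendsto_eq_intros)
  ultimately have "((\<lambda>h. (exp (\<i> * complex_of_real c * complex_of_real h) - 1) / complex_of_real h)
      \<longlongrightarrow> \<i> * complex_of_real c) (at 0)"
    by (rule filterlim_compose)
  then show ?thesis
    by (simp add: scaleR_conv_of_real divide_inverse mult_ac)
qed

lemma integrable_mult_unimodular:
  fixes g w :: "'a \<Rightarrow> complex"
  assumes "integrable M g" "w \<in> borel_measurable M" "\<And>x. norm (w x) = 1"
  shows "integrable M (\<lambda>x. g x * w x)"
  using assms(1)
proof (rule Bochner_Integration.integrable_bound)
  show "(\<lambda>x. g x * w x) \<in> borel_measurable M"
    using assms(1,2) by measurable
  show "AE x in M. norm (g x * w x) \<le> norm (g x)"
    using assms(3) by (simp add: norm_mult)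
qed

text \<open>
  This is dominated convergence. Since \<open>exp (\<i> a s)\<close> has modulus one, the difference quotient at
  \<open>s\<close> of the integrand is at most \<open>\<bar>a \<cdot> g\<bar>\<close> in modulus, whatever the increment.
\<close>

lemma has_vector_derivative_oscillatory_integral:
  fixes g :: "'a \<Rightarrow> complex" and a :: "'a \<Rightarrow> real"
  assumes g: "integrable M g"
    and ag: "integrable M (\<lambda>y. complex_of_real (a y) * g y)"
    and a [measurable]: "a \<in> borel_measurable M"
  shows "((\<lambda>t. LINT y|M. g y * exp (\<i> * complex_of_real (a y * t))) has_vector_derivative
          (LINT y|M. \<i> * complex_of_real (a y) * (g y * exp (\<i> * complex_of_real (a y * s))))) (at s)"
proof (rule has_vector_derivative_quotientI)
  have gm [measurable]: "g \<in> borel_measurable M"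
    using g by measurable
  let ?e = "\<lambda>t y. exp (\<i> * complex_of_real (a y * t))"
  define q where "q h y = g y * ?e s y * ((?e h y - 1) /\<^sub>R h)" for h y
  have int: "integrable M (\<lambda>y. g y * ?e t y)" for t
  proof (rule integrable_mult_unimodular[OF g])
    show "?e t \<in> borel_measurable M"
      by measurable
  qed (rule norm_exp_i_times)
  have quotient: "((LINT y|M. g y * ?e (s + h) y) - (LINT y|M. g y * ?e s y)) /\<^sub>R h
      = (LINT y|M. q h y)" for h
  proof -
    have "g y * ?e (s + h) y - g y * ?e s y = g y * ?e s y * (?e h y - 1)" for y
      by (simp add: algebra_simps exp_add)
    then have "(g y * ?e (s + h) y - g y * ?e s y) /\<^sub>R h = q h y" for y
      unfolding q_def by (simp only: mult_scaleR_right)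
    then show ?thesis
      by (simp only: Bochner_Integration.integral_diff[OF int int, symmetric]
          integral_scaleR_right[symmetric])
  qed
  have "((\<lambda>h. LINT y|M. q h y) \<longlongrightarrow>
      (LINT y|M. \<i> * complex_of_real (a y) * (g y * ?e s y))) (at 0)"
    unfolding tendsto_at_iff_sequentially comp_def
  proof (intro allI impI)
    fix X :: "nat \<Rightarrow> real"
    assume X: "\<forall>i. X i \<in> UNIV - {0}" "X \<longlonglongrightarrow> 0"
    show "(\<lambda>i. LINT y|M. q (X i) y) \<longlonglongrightarrow>
        (LINT y|M. \<i> * complex_of_real (a y) * (g y * ?e s y))"
    proof (rule integral_dominated_convergence[where w = "\<lambda>y. norm (complex_of_real (a y) * g y)"])
      show "integrable M (\<lambda>y. norm (complex_of_real (a y) * g y))"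
        using ag by (rule integrable_norm)
      show "AE y in M. (\<lambda>i. q (X i) y) \<longlonglongrightarrow> \<i> * complex_of_real (a y) * (g y * ?e s y)"
      proof (rule AE_I2)
        fix y
        have "filterlim X (at 0) sequentially"
          using X by (simp add: filterlim_at)
        from filterlim_compose[OF exp_imaginary_quotient_tendsto this, of "a y"]
        have "(\<lambda>i. q (X i) y) \<longlonglongrightarrow> g y * ?e s y * (\<i> * complex_of_real (a y))"
          unfolding q_def by (rule tendsto_mult[OF tendsto_const])
        then show "(\<lambda>i. q (X i) y) \<longlonglongrightarrow> \<i> * complex_of_real (a y) * (g y * ?e s y)"
          by (simp only: mult_ac)
      qed
      show "AE y in M. norm (q (X i) y) \<le> norm (complex_of_real (a y) * g y)" for i
      proof (rule AE_I2)
        fix y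
        have "norm ((?e (X i) y - 1) /\<^sub>R X i) \<le> \<bar>a y * X i\<bar> / \<bar>X i\<bar>"
          using divide_right_mono[OF norm_exp_imaginary_minus_one_le[of "a y * X i"], of "\<bar>X i\<bar>"]
          by (simp add: divide_inverse mult.commute)
        also have "\<dots> = \<bar>a y\<bar>"
          using X(1) by (simp add: abs_mult)
        finally have "norm (g y) * norm ((?e (X i) y - 1) /\<^sub>R X i) \<le> norm (g y) * \<bar>a y\<bar>"
          by (rule mult_left_mono) simp
        then show "norm (q (X i) y) \<le> norm (complex_of_real (a y) * g y)"
          unfolding q_def norm_mult norm_exp_i_times by (simp add: mult.commute)
      qed
    qed (unfold q_def, measurable)
  qed
  then show "((\<lambda>h. ((LINT y|M. g y * ?e (s + h) y) - (LINT y|M. g y * ?e s y)) /\<^sub>R h) \<longlongrightarrow>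
      (LINT y|M. \<i> * complex_of_real (a y) * (g y * ?e s y))) (at 0)"
    by (simp only: quotient)
qed

lemma norm_chirp [simp]: "norm (chirp \<alpha> x) = 1"
  by (simp add: chirp_def)

lemma chirp_uminus_mult_chirp: "chirp (- \<alpha>) x * chirp \<alpha> x = 1"
  by (simp add: chirp_def cot_def sum_negf flip: exp_add)

lemma borel_measurable_chirp: "chirp \<alpha> \<in> borel_measurable lebesgue"
  unfolding chirp_def
  by (intro measurable_completion)
     (auto intro!: borel_measurable_continuous_onI continuous_intros)

lemma chirp_uminus_mult_frft:
  fixes \<alpha> :: "real ^ 'n"
  shows "chirp (- \<alpha>) u * frft \<alpha> f u =
    frft_const \<alpha> / complex_of_real (sqrt (2 * pi)) ^ CARD('n) *
    (LINT x|lebesgue. f x * chirp \<alpha> x *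
       exp (- \<i> * complex_of_real (\<Sum>k\<in>UNIV. x $ k * u $ k * csc (\<alpha> $ k))))"
proof -
  have "c * (K * d * J) = K * J" if "c * d = 1" for c d K J :: complex
    using that by (metis mult.assoc mult.commute mult.left_neutral)
  then show ?thesis
    unfolding frft_def using chirp_uminus_mult_chirp by blast
qed

theorem lemma4p2:
  fixes \<alpha> :: "real ^ 'n" and k :: 'n and f :: "real ^ 'n \<Rightarrow> complex"
  assumes "\<And>j. \<alpha> $ j \<notin> range (\<lambda>m::int. pi * real_of_int m)"
    and "integrable lebesgue f"
    and "integrable lebesgue (\<lambda>x. complex_of_real (x $ k) * f x)"
  shows "\<forall>x. has_partial_deriv (\<lambda>x. chirp (- \<alpha>) x * frft \<alpha> f x) k
           (chirp (- \<alpha>) x *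
            frft \<alpha> (\<lambda>y. - \<i> * complex_of_real (y $ k) * complex_of_real (csc (\<alpha> $ k)) * f y) x) x"
proof
  fix x :: "real ^ 'n"
  define K where "K = frft_const \<alpha> / complex_of_real (sqrt (2 * pi)) ^ CARD('n)"
  define a where "a y = - (y $ k * csc (\<alpha> $ k))" for y :: "real ^ 'n"
  define b where "b y = - (\<Sum>j\<in>UNIV - {k}. y $ j * x $ j * csc (\<alpha> $ j))" for y :: "real ^ 'n"
  define w where "w y = chirp \<alpha> y * exp (\<i> * complex_of_real (b y))" for y
  define g where "g y = f y * w y" for y
  have a_meas: "a \<in> borel_measurable lebesgue"
    unfolding a_def
    by (intro measurable_completion) (auto intro!: borel_measurable_continuous_onI continuous_intros)
  have "b \<in> borel_measurable lebesgue"
    unfolding b_def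
    by (intro measurable_completion) (auto intro!: borel_measurable_continuous_onI continuous_intros)
  then have w_meas: "w \<in> borel_measurable lebesgue"
    unfolding w_def using borel_measurable_chirp by measurable
  have w_norm: "norm (w y) = 1" for y
    by (simp add: w_def norm_mult)
  have g_int: "integrable lebesgue g"
    unfolding g_def using assms(2) w_meas w_norm by (rule integrable_mult_unimodular)
  have "integrable lebesgue (\<lambda>y. complex_of_real (- csc (\<alpha> $ k)) * ((complex_of_real (y $ k) * f y) * w y))"
    by (intro integrable_mult_right integrable_mult_unimodular[OF assms(3) w_meas w_norm])
  then have ag_int: "integrable lebesgue (\<lambda>y. complex_of_real (a y) * g y)"
    by (simp add: a_def g_def mult_ac)
  \<comment> \<open>Along the line in direction \<open>k\<close> through \<open>x\<close>, \<open>b\<close> collects the part of the phase that is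
    independent of the parameter \<open>t\<close>.\<close>
  have split: "exp (- \<i> * complex_of_real (\<Sum>j\<in>UNIV. y $ j * (\<chi> j. if j = k then t else x $ j) $ j * csc (\<alpha> $ j)))
      = exp (\<i> * complex_of_real (b y)) * exp (\<i> * complex_of_real (a y * t))" for y t
  proof -
    have "(\<Sum>j\<in>UNIV. y $ j * (\<chi> j. if j = k then t else x $ j) $ j * csc (\<alpha> $ j))
        = - (b y + a y * t)"
      by (subst sum.remove[of _ k]) (auto simp: a_def b_def intro!: sum.cong)
    then show ?thesis
      by (simp only: exp_add[symmetric]) (simp add: algebra_simps)
  qed
  \<comment> \<open>Used with \<open>c = 1\<close> for the transform of \<open>f\<close> and with \<open>c = \<i> a\<close> for its derivative.\<close>
  have integral: "chirp (- \<alpha>) u * frft \<alpha> (\<lambda>y. c y * f y) u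
      = K * (LINT y|lebesgue. c y * (g y * exp (\<i> * complex_of_real (a y * t))))"
    if "u = (\<chi> j. if j = k then t else x $ j)" for c u t
    unfolding chirp_uminus_mult_frft K_def[symmetric] that split
    by (simp only: g_def w_def mult.assoc)
  have "((\<lambda>t. K * (LINT y|lebesgue. g y * exp (\<i> * complex_of_real (a y * t)))) has_vector_derivative
      K * (LINT y|lebesgue. \<i> * complex_of_real (a y) * (g y * exp (\<i> * complex_of_real (a y * x $ k))))) (at (x $ k))"
    using has_vector_derivative_oscillatory_integral[OF g_int ag_int a_meas]
    by (rule has_vector_derivative_mult_right)
  moreover have "chirp (- \<alpha>) u * frft \<alpha> f u = K * (LINT y|lebesgue. g y * exp (\<i> * complex_of_real (a y * t)))"
    if "u = (\<chi> j. if j = k then t else x $ j)" for u t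
    using integral[OF that, where c = "\<lambda>_. 1"] by simp
  moreover have "chirp (- \<alpha>) x *
        frft \<alpha> (\<lambda>y. - \<i> * complex_of_real (y $ k) * complex_of_real (csc (\<alpha> $ k)) * f y) x
      = K * (LINT y|lebesgue. \<i> * complex_of_real (a y) * (g y * exp (\<i> * complex_of_real (a y * x $ k))))"
  proof -
    have "x = (\<chi> j. if j = k then x $ k else x $ j)"
      by (simp add: vec_eq_iff)
    from integral[OF this, where c = "\<lambda>y. \<i> * complex_of_real (a y)"] show ?thesis
      by (simp add: a_def mult.assoc)
  qed
  ultimately show "has_partial_deriv (\<lambda>x. chirp (- \<alpha>) x * frft \<alpha> f x) k
           (chirp (- \<alpha>) x *
            frft \<alpha> (\<lambda>y. - \<i> * complex_of_real (y $ k) * complex_of_real (csc (\<alpha> $ k)) * f y) x) x"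
    by (simp only: has_partial_deriv_def)
qed

end
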